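(* Let $J$ be a Jordan curve in $\mathbb{K}^2$ with more than four points. If $\Gamma^{*}(\Gamma^{-1}(J))=J$, then $\mathbb{K}^2\setminus J$ has exactly two connected components. Moreover, each point of $J$ is adjacent to both components of $\mathbb{K}^2\setminus J$.
   Context: $\mathbb{K}$ is $\mathbb{Z}$ with the Khalimsky topology, generated by the sets $N(n)=\{n\}$ for $n$ odd and $N(n)=\{n-1,n,n+1\}$ for $n$ even; $\mathbb{K}^2$ has the product topology. For $x\in\mathbb{K}^2$, $N(x)$ is the smallest open set containing $x$, $cl(x)$ is the closure of $\{x\}$, and $A(x)=\{y\neq x:\{x,y\}\text{ is connected}\}$; a point $x$ is adjacent to a set $S$ if $A(x)\cap S\neq\emptyset$. A point of $\mathbb{K}^2$ is pure if its coordinates are both even or both odd, and mixed otherwise. An arc in $\mathbb{K}^2$ is a subset which, with the subspace topology, is homeomorphic to a finite interval of $\mathbb{K}$. A Jordan curve in $\mathbb{K}^2$ is a connected subset $J$ with $|J|\ge 4$ such that $J\setminus\{x\}$ is an arc for every $x\in J$. $\Gamma:\mathbb{Z}^2\to\mathbb{K}^2$ is $\Gamma(x,y)=(x+y,y-x)$. For $A\subseteq\mathbb{Z}^2$, $$\Gamma^*(A)=\Gamma(A)\cup\{x\in\mathbb{K}^2: x\text{ is mixed and } N(x)\subseteq\Gamma(A)\cup\{x\}\text{ or } cl(x)\subseteq\Gamma(A)\cup\{x\}\}.$$ *)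

theory Defs
  imports "HOL-Analysis.Analysis"
begin

definition khal_nbhd :: "int \<Rightarrow> int set" where
  "khal_nbhd n = (if odd n then {n} else {n - 1, n, n + 1})"

(* The type class topology on int is the discrete one, hence the abstract topologies. *)
definition khal :: "int topology" where
  "khal = topology_generated_by (range khal_nbhd)"

definition khal2 :: "(int \<times> int) topology" where
  "khal2 = prod_topology khal khal"

(* The smallest open set containing x; this intersection is itself open,
   see openin_min_nbhd and min_nbhd_subset below. *)
definition min_nbhd :: "int \<times> int \<Rightarrow> (int \<times> int) set" where
  "min_nbhd x = \<Inter>{U. openin khal2 U \<and> x \<in> U}"

definition point_cl :: "int \<times> int \<Rightarrow> (int \<times> int) set" where
  "point_cl x = khal2 closure_of {x}"

definition adjacency_set :: "int \<times> int \<Rightarrow> (int \<times> int) set" where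
  "adjacency_set x = {y. y \<noteq> x \<and> connectedin khal2 {x, y}}"

definition adjacent_to :: "int \<times> int \<Rightarrow> (int \<times> int) set \<Rightarrow> bool" where
  "adjacent_to x S \<longleftrightarrow> adjacency_set x \<inter> S \<noteq> {}"

definition pure_point :: "int \<times> int \<Rightarrow> bool" where
  "pure_point x \<longleftrightarrow> (even (fst x) \<and> even (snd x)) \<or> (odd (fst x) \<and> odd (snd x))"

definition mixed_point :: "int \<times> int \<Rightarrow> bool" where
  "mixed_point x \<longleftrightarrow> \<not> pure_point x"

definition khal_arc :: "(int \<times> int) set \<Rightarrow> bool" where
  "khal_arc S \<longleftrightarrow>
     (\<exists>a b. a \<le> b \<and> subtopology khal2 S homeomorphic_space subtopology khal {a..b})"

(* Although card is 0 on infinite sets, the condition on card J excludes nothing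
   else: arcs are finite, so J is finite as soon as J - {x} is an arc. *)
definition jordan_curve :: "(int \<times> int) set \<Rightarrow> bool" where
  "jordan_curve J \<longleftrightarrow>
     connectedin khal2 J \<and> card J \<ge> 4 \<and> (\<forall>x\<in>J. khal_arc (J - {x}))"

definition Gamma_map :: "int \<times> int \<Rightarrow> int \<times> int" where
  "Gamma_map p = (fst p + snd p, snd p - fst p)"

(* "Mixed" governs both alternatives: every closed point x has cl(x) = {x}, so
   otherwise all points with two even coordinates would belong to Gamma_star A. *)
definition Gamma_star :: "(int \<times> int) set \<Rightarrow> (int \<times> int) set" where
  "Gamma_star A = Gamma_map ` A \<union>
     {x. mixed_point x \<and>
         (min_nbhd x \<subseteq> Gamma_map ` A \<union> {x} \<or> point_cl x \<subseteq> Gamma_map ` A \<union> {x})}"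

lemma min_nbhd_subset: "openin khal2 U \<Longrightarrow> x \<in> U \<Longrightarrow> min_nbhd x \<subseteq> U"
  unfolding min_nbhd_def by blast

lemma khal_nbhd_subset:
  assumes "openin khal U" "n \<in> U"
  shows "khal_nbhd n \<subseteq> U"
proof -
  have "generate_topology_on (range khal_nbhd) U"
    using assms(1) unfolding khal_def openin_topology_generated_by_iff .
  then have "\<forall>n\<in>U. khal_nbhd n \<subseteq> U"
  proof induction
    case (Basis s)
    then obtain m where "s = khal_nbhd m" by auto
    then show ?case by (auto simp: khal_nbhd_def split: if_splits)
  next
    case (Int U V)
    then show ?case by (meson IntD1 IntD2 Int_greatest)
  next
    case (UN K)
    then show ?case by (meson UnionE Union_upper order_trans)
  qed simp
  with assms(2) show ?thesis by (rule bspec[rotated])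
qed

lemma openin_khal_nbhd: "openin khal (khal_nbhd n)"
  unfolding khal_def by (rule topology_generated_by_Basis) (rule rangeI)

lemma min_nbhd_eq: "min_nbhd (a, b) = khal_nbhd a \<times> khal_nbhd b"
proof
  have "openin khal2 (khal_nbhd a \<times> khal_nbhd b)"
    unfolding khal2_def by (simp add: openin_prod_Times_iff openin_khal_nbhd)
  then show "min_nbhd (a, b) \<subseteq> khal_nbhd a \<times> khal_nbhd b"
    by (rule min_nbhd_subset) (auto simp: khal_nbhd_def)
  show "khal_nbhd a \<times> khal_nbhd b \<subseteq> min_nbhd (a, b)"
  proof
    fix p
    assume p: "p \<in> khal_nbhd a \<times> khal_nbhd b"
    have "p \<in> U" if U: "openin khal2 U" "(a, b) \<in> U" for U
    proof -
      have "\<exists>V W. openin khal V \<and> openin khal W \<and> a \<in> V \<and> b \<in> W \<and> V \<times> W \<subseteq> U"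
        using U unfolding khal2_def openin_prod_topology_alt by (elim allE impE)
      then obtain V W where VW: "openin khal V" "openin khal W" "a \<in> V" "b \<in> W"
        and sub: "V \<times> W \<subseteq> U"
        by (elim exE conjE)
      from p have "p \<in> V \<times> W"
        by (rule subsetD[OF Sigma_mono[OF khal_nbhd_subset[OF VW(1,3)] khal_nbhd_subset[OF VW(2,4)]]])
      with sub show ?thesis by (rule subsetD)
    qed
    then show "p \<in> min_nbhd (a, b)"
      unfolding min_nbhd_def by (simp only: Inter_iff mem_Collect_eq) simp
  qed
qed

lemma openin_min_nbhd: "openin khal2 (min_nbhd x)"
  by (cases x) (simp add: min_nbhd_eq khal2_def openin_prod_Times_iff openin_khal_nbhd)

lemma topspace_khal2: "topspace khal2 = UNIV"
proof -
  have "n \<in> khal_nbhd n" for n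
    by (simp add: khal_nbhd_def)
  then have "n \<in> topspace khal" for n
    using openin_subset[OF openin_khal_nbhd, of n] by (simp add: subset_iff)
  then have "topspace khal = UNIV"
    by (simp add: set_eq_iff)
  then show ?thesis
    by (simp add: khal2_def)
qed

end

(*
  Two points are adjacent in K^2 iff they differ by a unit horizontal or vertical step, or by a
  diagonal step between pure points.  Hence the adjacency graph triangulates the plane, and a
  Jordan curve with more than four points is a connected set J in which every point has exactly
  two neighbours in J and no three points are mutually adjacent.

  Colour each triangle by the parity of the number of edges of J crossed by a horizontal ray that
  leaves it to the right.  Since all degrees in J are even, the colours of two triangles sharing an
  edge differ iff that edge belongs to J.  All triangles at a point outside J thus have the
  same colour, which yields a locally constant map side on the complement of J.  The link of a point
  of J is cut by the two neighbours in J into two nonempty arcs, on opposite sides; following J, all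
  points next to J on a given side lie in one component.  As every point can be joined to a point
  next to J, the components are the two fibres of side.
*)
theory Submission
  imports Defs
begin

subsection \<open>Adjacency in the Khalimsky plane\<close>

text \<open>The parity condition says that \<open>p\<close> is pure. It names only one end because a
  diagonal step preserves the parity of the coordinate sum.\<close>

definition kadj :: "int \<times> int \<Rightarrow> int \<times> int \<Rightarrow> bool" where
  "kadj p q \<longleftrightarrow> p \<noteq> q \<and> \<bar>fst p - fst q\<bar> \<le> 1 \<and> \<bar>snd p - snd q\<bar> \<le> 1 \<and>
     (fst p = fst q \<or> snd p = snd q \<or> even (fst p + snd p))"

lemma kadj_sym: "kadj p q \<longleftrightarrow> kadj q p"
proof -
  have "kadj q p" if "kadj p q" for p q
    using that unfolding kadj_def by (cases p; cases q) (simp; presburger)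
  then show ?thesis by blast
qed

lemma mem_khal_nbhd_iff: "m \<in> khal_nbhd n \<longleftrightarrow> m = n \<or> even n \<and> \<bar>m - n\<bar> = 1"
  by (auto simp: khal_nbhd_def)

text \<open>A unit step joins an even coordinate to an odd one, and only the even one has the other
  in its neighbourhood. For a diagonal step both coordinates must be even at the same end, so the
  ends are pure.\<close>

lemma kadj_iff_min_nbhd: "kadj x y \<longleftrightarrow> x \<noteq> y \<and> (y \<in> min_nbhd x \<or> x \<in> min_nbhd y)"
proof (cases x, cases y)
  fix a b c d assume xy: "x = (a, b)" "y = (c, d)"
  have parity: "even m \<longleftrightarrow> odd n" if "\<bar>m - n\<bar> = 1" for m n :: int
    using that by presburger
  have le: "\<bar>m - n\<bar> \<le> 1 \<longleftrightarrow> m = n \<or> \<bar>m - n\<bar> = 1" for m n :: int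
    by arith
  show ?thesis
    unfolding kadj_def xy min_nbhd_eq mem_Times_iff mem_khal_nbhd_iff fst_conv snd_conv le
      abs_minus_commute[of c a] abs_minus_commute[of d b] even_add prod.inject
    using parity[of a c] parity[of b d] by argo
qed

lemma self_in_min_nbhd: "x \<in> min_nbhd x"
  by (simp add: min_nbhd_def)

text \<open>The minimal neighbourhoods of the points of \<open>S\<close> and those of
  \<open>T - S\<close> would otherwise separate \<open>T\<close>. This serves as induction along
  adjacency in a connected set.\<close>

lemma kadj_closed_subset_connectedin:
  assumes "connectedin khal2 T" "S \<subseteq> T" "S \<noteq> {}"
    and closed: "\<And>x y. x \<in> S \<Longrightarrow> y \<in> T \<Longrightarrow> kadj x y \<Longrightarrow> y \<in> S"
  shows "S = T"
proof (rule ccontr)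
  assume "S \<noteq> T"
  let ?U = "\<Union>x\<in>S. min_nbhd x" and ?V = "\<Union>x\<in>T - S. min_nbhd x"
  have "openin khal2 ?U" "openin khal2 ?V"
    by (auto intro!: openin_Union openin_min_nbhd)
  moreover have "T \<subseteq> ?U \<union> ?V"
    using self_in_min_nbhd by fast
  moreover have "?U \<inter> ?V \<inter> T = {}"
  proof -
    have "?U \<inter> T \<subseteq> S" "?V \<inter> T \<subseteq> T - S"
      using closed kadj_iff_min_nbhd by blast+
    then show ?thesis by blast
  qed
  moreover have "?U \<inter> T \<noteq> {}" "?V \<inter> T \<noteq> {}"
    using assms(2,3) \<open>S \<noteq> T\<close> self_in_min_nbhd by blast+
  ultimately show False
    by (rule connectedinD[OF assms(1)])
qed

section \<open>Connected sets of the Khalimsky line and plane\<close>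

lemma connectedin_pairI:
  assumes "x \<in> topspace X" "y \<in> topspace X" "\<And>U. openin X U \<Longrightarrow> x \<in> U \<Longrightarrow> y \<in> U"
  shows "connectedin X {x, y}"
  unfolding connectedin
proof (intro conjI notI)
  assume "\<exists>E1 E2. openin X E1 \<and> openin X E2 \<and> {x, y} \<subseteq> E1 \<union> E2 \<and> E1 \<inter> E2 \<inter> {x, y} = {} \<and>
    E1 \<inter> {x, y} \<noteq> {} \<and> E2 \<inter> {x, y} \<noteq> {}"
  then obtain U V where "openin X U" "openin X V" "{x, y} \<subseteq> U \<union> V"
    "U \<inter> V \<inter> {x, y} = {}" "U \<inter> {x, y} \<noteq> {}" "V \<inter> {x, y} \<noteq> {}"
    by (elim exE conjE)
  then show False using assms(3)[of U] assms(3)[of V] by blast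
qed (use assms in auto)

lemma connectedin_pair_iff: "connectedin khal2 {x, y} \<longleftrightarrow> x = y \<or> kadj x y"
proof
  assume "connectedin khal2 {x, y}"
  then have "{x} = {x, y}" if "\<not> kadj x y"
    by (rule kadj_closed_subset_connectedin) (use that in auto)
  then show "x = y \<or> kadj x y" by blast
next
  have *: "connectedin khal2 {x, y}" if "y \<in> min_nbhd x" for x y
    using that by (intro connectedin_pairI) (simp_all add: topspace_khal2 min_nbhd_subset[THEN subsetD])
  assume "x = y \<or> kadj x y"
  then show "connectedin khal2 {x, y}"
    using *[of x y] *[of y x] by (auto simp: kadj_iff_min_nbhd topspace_khal2 insert_commute)
qed

lemma adjacency_set_eq: "adjacency_set x = {y. kadj x y}"
  by (auto simp: adjacency_set_def connectedin_pair_iff kadj_def)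

lemma topspace_khal: "topspace khal = UNIV"
  using topspace_khal2 by (auto simp: khal2_def)

lemma connectedin_khal_pair: "connectedin khal {n, m} \<Longrightarrow> \<bar>n - m\<bar> \<le> 1"
proof (rule ccontr)
  assume c: "connectedin khal {n, m}" and "\<not> \<bar>n - m\<bar> \<le> 1"
  then have "n \<notin> khal_nbhd m" "m \<notin> khal_nbhd n"
    by (auto simp: khal_nbhd_def)
  moreover have "n \<in> khal_nbhd n" "m \<in> khal_nbhd m"
    by (auto simp: khal_nbhd_def)
  ultimately show False
    using c openin_khal_nbhd[of n] openin_khal_nbhd[of m] unfolding connectedin
    by blast
qed

lemma connectedin_khal_succ: "connectedin khal {n, n + 1}"
proof -
  have *: "connectedin khal {x, y}" if "y \<in> khal_nbhd x" for x y
    using that by (intro connectedin_pairI) (simp_all add: topspace_khal khal_nbhd_subset[THEN subsetD])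
  show ?thesis
    using *[of "n + 1" n] *[of n "n + 1"]
    by (cases "even n") (auto simp: khal_nbhd_def insert_commute)
qed

lemma connectedin_khal_interval: "connectedin khal {a..b}"
proof (cases "a \<le> b")
  case True
  then show ?thesis
  proof (induction rule: int_ge_induct)
    case base
    then show ?case by (simp add: topspace_khal)
  next
    case (step b)
    have "{a..b + 1} = {a..b} \<union> {b, b + 1}" using step.hyps by auto
    then show ?case
      using connectedin_Un[OF step.IH connectedin_khal_succ[of b]] step.hyps by auto
  qed
qed simp

lemma connected_space_khal2: "connected_space khal2"
proof -
  have "connected_space khal"
    unfolding connected_space_subconnected topspace_khal
    using connectedin_khal_interval[of "min _ _" "max _ _"]
    by (metis atLeastAtMost_iff max.cobounded1 max.cobounded2 min.cobounded1 min.cobounded2 subset_UNIV)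
  then show ?thesis
    by (simp add: khal2_def connected_space_prod_topology)
qed

section \<open>Arcs and Jordan curves as subgraphs\<close>

text \<open>An adjacent pair is a connected set, so a homeomorphism onto an interval maps it to a
  connected pair of integers.\<close>

lemma khal_arc_embedding:
  assumes "khal_arc S"
  obtains h :: "int \<times> int \<Rightarrow> int" where "inj_on h S"
    and "\<forall>x\<in>S. \<forall>y\<in>S. kadj x y \<longrightarrow> \<bar>h x - h y\<bar> \<le> 1"
proof -
  obtain a b where "subtopology khal2 S homeomorphic_space subtopology khal {a..b}"
    using assms unfolding khal_arc_def by blast
  then obtain h where h: "homeomorphic_map (subtopology khal2 S) (subtopology khal {a..b}) h"
    unfolding homeomorphic_space by blast
  show ?thesis
  proof (intro that ballI impI)
    show "inj_on h S"
      using h homeomorphic_imp_injective_map[OF h] by (simp add: topspace_khal2)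
    fix x y assume xy: "x \<in> S" "y \<in> S" "kadj x y"
    then have "connectedin (subtopology khal2 S) {x, y}"
      by (simp add: connectedin_subtopology connectedin_pair_iff)
    then have "connectedin (subtopology khal {a..b}) (h ` {x, y})"
      using h connectedin_continuous_map_image homeomorphic_imp_continuous_map by blast
    then show "\<bar>h x - h y\<bar> \<le> 1"
      by (simp add: connectedin_subtopology connectedin_khal_pair)
  qed
qed

lemma khal_arc_connectedin: "khal_arc S \<Longrightarrow> connectedin khal2 S"
  unfolding khal_arc_def
  using homeomorphic_connected_space connectedin_khal_interval
  by (metis connectedin_def subset_UNIV topspace_khal2)

text \<open>Three distinct integers cannot be pairwise at distance at most 1.\<close>

lemma khal_arc_no_triangle:
  assumes "khal_arc S" "p \<in> S" "q \<in> S" "r \<in> S" "kadj p q" "kadj q r" "kadj p r"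
  shows False
proof -
  obtain h :: "int \<times> int \<Rightarrow> int"
    where h: "inj_on h S" "\<forall>x\<in>S. \<forall>y\<in>S. kadj x y \<longrightarrow> \<bar>h x - h y\<bar> \<le> 1"
    using khal_arc_embedding[OF assms(1)] by blast
  have "p \<noteq> q" "q \<noteq> r" "p \<noteq> r" using assms by (auto simp: kadj_def)
  then have "h p \<noteq> h q" "h q \<noteq> h r" "h p \<noteq> h r" using h(1) assms by (auto dest: inj_onD)
  then show False using h(2)[rule_format, of p q] h(2)[rule_format, of q r] h(2)[rule_format, of p r] assms by auto
qed

text \<open>Only two integers are at distance 1 from a given one.\<close>

lemma khal_arc_no_fork:
  assumes "khal_arc S" "v \<in> S" "p \<in> S" "q \<in> S" "r \<in> S" "kadj v p" "kadj v q" "kadj v r"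
    and "p \<noteq> q" "q \<noteq> r" "p \<noteq> r"
  shows False
proof -
  obtain h :: "int \<times> int \<Rightarrow> int"
    where h: "inj_on h S" "\<forall>x\<in>S. \<forall>y\<in>S. kadj x y \<longrightarrow> \<bar>h x - h y\<bar> \<le> 1"
    using khal_arc_embedding[OF assms(1)] by blast
  have "v \<noteq> p" "v \<noteq> q" "v \<noteq> r" using assms by (auto simp: kadj_def)
  then have "h v \<noteq> h p" "h v \<noteq> h q" "h v \<noteq> h r" "h p \<noteq> h q" "h q \<noteq> h r" "h p \<noteq> h r"
    using h(1) assms by (auto dest: inj_onD)
  then show False using h(2)[rule_format, of v p] h(2)[rule_format, of v q] h(2)[rule_format, of v r] assms by auto
qed

text \<open>Removing a fourth point of \<open>J\<close> would leave the triangle inside an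
  arc.\<close>

lemma jordan_curve_no_triangle:
  assumes "jordan_curve J" "p \<in> J" "q \<in> J" "r \<in> J" "kadj p q" "kadj q r"
  shows "\<not> kadj p r"
proof
  assume "kadj p r"
  have "\<not> J \<subseteq> {p, q, r}"
  proof
    assume "J \<subseteq> {p, q, r}"
    then have "card J \<le> card {p, q, r}" by (intro card_mono) auto
    also have "\<dots> \<le> 3" by (simp add: card_insert_if)
    finally show False using assms(1) by (simp add: jordan_curve_def)
  qed
  then obtain x where "x \<in> J" "x \<notin> {p, q, r}" by blast
  then show False
    using assms \<open>kadj p r\<close> khal_arc_no_triangle[of "J - {x}" p q r]
    by (auto simp: jordan_curve_def)
qed

text \<open>Three neighbours of \<open>v\<close> would form a fork in the arc obtained by removing a
  fifth point; this is where more than four points are required.\<close>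

lemma jordan_curve_neighbours:
  assumes J: "jordan_curve J" and "card J > 4" and v: "v \<in> J"
  obtains p q where "p \<noteq> q" "{w \<in> J. kadj v w} = {p, q}"
proof -
  \<comment> \<open>Removing \<open>u\<close> leaves a connected set with further points besides
    \<open>v\<close>, in which \<open>v\<close> cannot be isolated.\<close>
  have ex: "\<exists>w\<in>J. kadj v w \<and> w \<noteq> u" if u: "u \<in> J" "u \<noteq> v" for u
  proof (rule ccontr)
    assume no: "\<not> (\<exists>w\<in>J. kadj v w \<and> w \<noteq> u)"
    have "connectedin khal2 (J - {u})"
      using J u by (auto simp: jordan_curve_def intro: khal_arc_connectedin)
    then have "{v} = J - {u}"
      by (rule kadj_closed_subset_connectedin) (use no v u in auto)
    then have "J = {u, v}" using u v by auto
    then show False using assms(2) by (simp add: card_insert_if split: if_splits)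
  qed
  have "\<not> J \<subseteq> {v}"
    using assms(2) card_mono[of "{v}" J] by auto
  then obtain u where "u \<in> J" "u \<noteq> v" by blast
  then obtain p where p: "p \<in> J" "kadj v p" using ex by blast
  then have "p \<noteq> v" by (auto simp: kadj_def)
  then obtain q where q: "q \<in> J" "kadj v q" "q \<noteq> p" using ex p by blast
  have "r \<in> {p, q}" if r: "r \<in> J" "kadj v r" for r
  proof (rule ccontr)
    assume "r \<notin> {p, q}"
    have "\<not> J \<subseteq> {v, p, q, r}"
    proof
      assume "J \<subseteq> {v, p, q, r}"
      then have "card J \<le> card {v, p, q, r}" by (intro card_mono) auto
      also have "\<dots> \<le> 4" by (simp add: card_insert_if)
      finally show False using assms(2) by simp
    qed
    then obtain x where "x \<in> J" "x \<notin> {v, p, q, r}" by blast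
    then show False
      using J v p q r \<open>r \<notin> {p, q}\<close> khal_arc_no_fork[of "J - {x}" v p q r]
      by (auto simp: jordan_curve_def)
  qed
  then have "{w \<in> J. kadj v w} = {p, q}" using p q by blast
  with q(3) that show thesis by metis
qed

subsection \<open>Links of points\<close>

text \<open>The eight unit steps counterclockwise, extended periodically so that arcs may run past
  index 0. Even indices are the axis directions.\<close>

definition ring :: "int \<Rightarrow> int \<times> int" where
  "ring k = ([(1, 0), (1, 1), (0, 1), (-1, 1), (-1, 0), (-1, -1), (0, -1), (1, -1)] ! nat (k mod 8))"

text \<open>The four neighbours of a mixed point are those in the even directions of ring.\<close>
definition link :: "int \<times> int \<Rightarrow> int \<Rightarrow> int \<times> int" where
  "link v k = (if even (fst v + snd v) then v + ring k else v + ring (2 * k))"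

definition link_length :: "int \<times> int \<Rightarrow> int" where
  "link_length v = (if even (fst v + snd v) then 8 else 4)"

lemma ring_simps:
  "ring 0 = (1, 0)" "ring 1 = (1, 1)" "ring 2 = (0, 1)" "ring 3 = (-1, 1)"
  "ring 4 = (-1, 0)" "ring 5 = (-1, -1)" "ring 6 = (0, -1)" "ring 7 = (1, -1)"
  "ring 8 = (1, 0)" "ring (-1) = (1, -1)" "ring (-2) = (0, -1)"
  by (simp_all add: ring_def)

lemma link_periodic:
  assumes "k mod link_length v = l mod link_length v"
  shows "link v k = link v l"
proof -
  have "(2 * m) mod 8 = 2 * (m mod 4)" for m :: int by presburger
  with assms show ?thesis
    by (simp add: link_def link_length_def ring_def split: if_splits)
qed

text \<open>Reduces the index to one period while keeping all shifts \<open>d\<close>, so that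
  consecutive link points can be treated together in finitely many cases.\<close>

lemma link_cases:
  obtains r where "r \<in> {0..<link_length v}" "\<And>d. link v (k + d) = link v (r + d)"
proof
  show "k mod link_length v \<in> {0..<link_length v}"
    by (simp add: link_length_def)
  show "link v (k + d) = link v (k mod link_length v + d)" for d
    by (rule link_periodic) (simp add: mod_add_left_eq)
qed

lemma link_indices:
  "{0..<link_length v} = (if even (fst v + snd v) then {0, 1, 2, 3, 4, 5, 6, 7} else {0, 1, 2, 3})"
  by (auto simp: link_length_def)

lemma link_range: "kadj v w \<longleftrightarrow> w \<in> link v ` {0..<link_length v}"
proof -
  obtain x y a b where v: "v = (x, y)" and w: "w = (x + a, y + b)"
    by (metis add_diff_cancel_left' diff_add_cancel add.commute surj_pair)
  have "\<bar>a\<bar> \<le> 1 \<longleftrightarrow> a \<in> {-1, 0, 1}" "\<bar>b\<bar> \<le> 1 \<longleftrightarrow> b \<in> {-1, 0, 1}" by auto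
  then have *: "kadj v w \<longleftrightarrow> a \<in> {-1, 0, 1} \<and> b \<in> {-1, 0, 1} \<and> (a, b) \<noteq> (0, 0) \<and>
      (a = 0 \<or> b = 0 \<or> even (x + y))"
    unfolding kadj_def v w by auto
  have shift: "z + c = z \<longleftrightarrow> c = 0" "z + c = z + 1 \<longleftrightarrow> c = 1" "z + c = z - 1 \<longleftrightarrow> c = - 1" for z c :: int
    by auto
  show ?thesis
  proof (cases "even (x + y)")
    case True
    then have "link v ` {0..<link_length v} =
        {(x + 1, y), (x + 1, y + 1), (x, y + 1), (x - 1, y + 1), (x - 1, y), (x - 1, y - 1), (x, y - 1), (x + 1, y - 1)}"
      unfolding link_indices by (simp add: v link_def ring_simps)
    with True show ?thesis
      unfolding * unfolding w by (simp only: insert_iff empty_iff prod.inject shift)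
        (cases "a = -1"; cases "a = 0"; cases "a = 1"; cases "b = -1"; cases "b = 0"; cases "b = 1"; simp)
  next
    case False
    then have "link v ` {0..<link_length v} = {(x + 1, y), (x, y + 1), (x - 1, y), (x, y - 1)}"
      unfolding link_indices by (simp add: v link_def ring_simps)
    with False show ?thesis
      unfolding * unfolding w by (simp only: insert_iff empty_iff prod.inject shift)
        (cases "a = -1"; cases "a = 0"; cases "a = 1"; cases "b = -1"; cases "b = 0"; cases "b = 1"; simp)
  qed
qed

lemma link_inj: "inj_on (link v) {0..<link_length v}"
  unfolding link_indices by (cases v) (auto simp: link_def ring_simps)

lemma kadj_link: "kadj v (link v k)"
proof -
  obtain r where "r \<in> {0..<link_length v}" "\<And>d. link v (k + d) = link v (r + d)"
    using link_cases by blast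
  then show ?thesis
    unfolding link_range by (metis add.right_neutral image_eqI)
qed

lemma kadj_link_link: "kadj (link v k) (link v (k + 1))"
proof -
  obtain r where r: "r \<in> {0..<link_length v}" "\<And>d. link v (k + d) = link v (r + d)"
    using link_cases by blast
  have "kadj (link v r) (link v (r + 1))"
    using r(1) unfolding link_indices
    by (cases v) (auto simp: link_def ring_simps kadj_def split: if_splits)
  then show ?thesis using r(2)[of 0] r(2)[of 1] by simp
qed

text \<open>Adjacent neighbours of \<open>v\<close> are cyclically consecutive in its link: around a
  pure point the axis neighbours are mixed and have no diagonal steps, and around a mixed point
  opposite neighbours are too far apart.\<close>

lemma link_triangle:
  assumes "kadj v p" "kadj v q" "kadj p q"
  shows "\<exists>k. {p, q} = {link v k, link v (k + 1)}"
proof -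
  obtain r s where rs: "r \<in> {0..<link_length v}" "s \<in> {0..<link_length v}" "p = link v r" "q = link v s"
    using assms link_range by blast
  obtain x y where v: "v = (x, y)" by (cases v)
  \<comment> \<open>The last two alternatives are the wrap-around from the last link point to the
    first.\<close>
  have "s = r + 1 \<or> r = s + 1 \<or> s = 0 \<and> r + 1 = link_length v \<or> r = 0 \<and> s + 1 = link_length v"
  proof (cases "even (x + y)")
    case True
    then have "r \<in> {0, 1, 2, 3, 4, 5, 6, 7}" "s \<in> {0, 1, 2, 3, 4, 5, 6, 7}"
      using rs(1,2) by (simp_all add: link_indices v)
    with True assms(3) show ?thesis
      unfolding rs(3,4)
      by (elim insertE emptyE) (simp_all add: v link_length_def link_def ring_simps kadj_def)
  next
    case False
    then have "r \<in> {0, 1, 2, 3}" "s \<in> {0, 1, 2, 3}"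
      using rs(1,2) by (simp_all add: link_indices v)
    with False assms(3) show ?thesis
      unfolding rs(3,4)
      by (elim insertE emptyE) (simp_all add: v link_length_def link_def ring_simps kadj_def)
  qed
  then have "q = link v (r + 1) \<or> p = link v (s + 1)"
    unfolding rs using link_periodic[of 0 v "link_length v"] by (metis mod_0 mod_self)
  then show ?thesis using rs by (metis insert_commute)
qed

subsection \<open>Crossing parities\<close>

text \<open>The combinatorial content of a Jordan curve with more than four points: a finite
  connected set whose adjacency graph is 2-regular and has no triangle.\<close>

locale khal_cycle =
  fixes J :: "(int \<times> int) set"
  assumes connected: "connectedin khal2 J"
    and finite: "finite J"
    and nonempty: "J \<noteq> {}"
    and neighbours: "\<And>v. v \<in> J \<Longrightarrow> \<exists>p q. p \<noteq> q \<and> {w \<in> J. kadj v w} = {p, q}"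
    and no_triangle: "\<And>p q r. p \<in> J \<Longrightarrow> q \<in> J \<Longrightarrow> r \<in> J \<Longrightarrow> kadj p q \<Longrightarrow> kadj q r \<Longrightarrow> \<not> kadj p r"
begin

definition edge :: "int \<times> int \<Rightarrow> int \<times> int \<Rightarrow> nat" where
  "edge p q = of_bool (p \<in> J \<and> q \<in> J \<and> kadj p q)"

definition edges_to_row :: "int \<Rightarrow> int \<Rightarrow> int \<Rightarrow> nat" where
  "edges_to_row d i j =
     edge (i, j) (i - 1, j + d) + edge (i, j) (i, j + d) + edge (i, j) (i + 1, j + d)"

definition xbound :: int where
  "xbound = Max (insert 0 (fst ` J))"

text \<open>
  With d = 1 or d = - 1: the edges between the rows j and j + d whose end in row j lies to the right
  of (i, j).
\<close>
definition crossings :: "int \<Rightarrow> int \<Rightarrow> int \<Rightarrow> nat" where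
  "crossings d i j = (\<Sum>k\<in>{i + 1..xbound}. edges_to_row d k j)"

lemma edge_sym: "edge p q = edge q p"
  by (auto simp: edge_def kadj_sym)

lemma edge_beyond: "k > xbound \<Longrightarrow> edge (k, j) q = 0"
proof -
  assume "k > xbound"
  then have "(k, j) \<notin> J"
    using Max_ge[of "insert 0 (fst ` J)" k] finite by (force simp: xbound_def)
  then show ?thesis by (simp add: edge_def)
qed

text \<open>Beyond \<open>xbound\<close> both sums are empty and \<open>(i, j)\<close> carries no
  edge.\<close>

lemma crossings_step: "crossings d (i - 1) j = crossings d i j + edges_to_row d i j"
proof (cases "i \<le> xbound")
  case True
  then have "{i - 1 + 1..xbound} = insert i {i + 1..xbound}" by auto
  then show ?thesis by (simp add: crossings_def)
next
  case False
  then show ?thesis by (simp add: crossings_def edges_to_row_def edge_beyond)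
qed

lemma crossings_beyond: "i \<ge> xbound \<Longrightarrow> crossings d i j = 0"
  by (simp add: crossings_def)

text \<open>Parity identities are trivial to the right of \<open>J\<close>, where no edge is left to
  count, and are carried leftwards column by column.\<close>

lemma left_induct [case_names beyond step]:
  assumes "\<And>i. i > xbound \<Longrightarrow> P i" "\<And>i. P i \<Longrightarrow> P (i - 1)"
  shows "P i"
proof (cases "i \<le> xbound + 1")
  case True
  then show ?thesis
  proof (induction rule: int_le_induct)
    case base
    show ?case by (rule assms(1)) simp
  next
    case (step i)
    show ?case by (rule assms(2)) (rule step.IH)
  qed
next
  case False
  then show ?thesis by (intro assms(1)) simp
qed

text \<open>The sum is the degree of \<open>(i, j)\<close> in \<open>J\<close>: 2 on
  \<open>J\<close> and 0 elsewhere.\<close>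

lemma even_degree:
  "even (edges_to_row 1 i j + edges_to_row (- 1) i j + edge (i, j) (i - 1, j) + edge (i, j) (i + 1, j))"
proof (cases "(i, j) \<in> J")
  case True
  let ?N = "{(i - 1, j + 1), (i, j + 1), (i + 1, j + 1), (i - 1, j - 1), (i, j - 1), (i + 1, j - 1),
     (i - 1, j), (i + 1, j)}"
  have sub: "{w \<in> J. kadj (i, j) w} \<subseteq> ?N"
  proof
    fix w assume "w \<in> {w \<in> J. kadj (i, j) w}"
    moreover obtain a b where w: "w = (a, b)" by (cases w)
    ultimately have "a \<in> {i - 1, i, i + 1}" "b \<in> {j - 1, j, j + 1}" "(a, b) \<noteq> (i, j)"
      by (auto simp: kadj_def)
    then show "w \<in> ?N" unfolding w by blast
  qed
  obtain p q where "p \<noteq> q" "{w \<in> J. kadj (i, j) w} = {p, q}"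
    using neighbours[OF True] by blast
  then have "2 = card {w \<in> J. kadj (i, j) w}" by simp
  also have "\<dots> = (\<Sum>w\<in>{w \<in> J. kadj (i, j) w}. edge (i, j) w)"
    using True by (simp add: edge_def)
  also have "\<dots> = (\<Sum>w\<in>?N. edge (i, j) w)"
    using sub by (intro sum.mono_neutral_left) (simp_all add: edge_def)
  also have "\<dots> = edges_to_row 1 i j + edges_to_row (- 1) i j + edge (i, j) (i - 1, j) + edge (i, j) (i + 1, j)"
    by (simp add: edges_to_row_def)
  finally show ?thesis by (metis even_numeral)
qed (simp add: edges_to_row_def edge_def)

text \<open>Moving from \<open>i\<close> to \<open>i - 1\<close> changes the parity of the sum by
  the degree of \<open>(i, j)\<close>, which is even.\<close>

lemma crossings_horizontal:
  "even (crossings 1 i j + crossings (- 1) i j + edge (i, j) (i + 1, j))"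
proof (induction i rule: left_induct)
  case (beyond i)
  then show ?case by (simp add: crossings_beyond edge_beyond)
next
  case (step i)
  have "edge (i - 1, j) (i - 1 + 1, j) = edge (i, j) (i - 1, j)"
    by (simp add: edge_sym)
  with step even_degree[of i j] show ?case
    unfolding crossings_step even_add by auto
qed

text \<open>Both counts concern the edges between rows \<open>j\<close> and \<open>j + 1\<close>,
  one by the lower end and the other by the upper end. They disagree only on edges with exactly one
  end to the right of column \<open>i\<close>, which are the two diagonals listed.\<close>

lemma crossings_diagonal:
  "even (crossings 1 i j + crossings (- 1) i (j + 1)
     + edge (i, j) (i + 1, j + 1) + edge (i + 1, j) (i, j + 1))"
proof (induction i rule: left_induct)
  case (beyond i)
  then show ?case by (simp add: crossings_beyond edge_beyond edge_sym[of _ "(i, j + 1)"])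
next
  case (step i)
  have "edge (i - 1, j) (i - 1 + 1, j + 1) = edge (i, j + 1) (i - 1, j + 1 + - 1)"
    "edge (i, j) (i, j + 1) = edge (i, j + 1) (i, j + 1 + - 1)"
    "edge (i + 1, j) (i, j + 1) = edge (i, j + 1) (i + 1, j + 1 + - 1)"
    "edge (i - 1 + 1, j) (i - 1, j + 1) = edge (i, j) (i - 1, j + 1)"
    by (simp_all add: edge_sym)
  with step show ?case
    unfolding crossings_step edges_to_row_def even_add by auto
qed

lemma edges_to_row_mixed:
  assumes "odd (i + j)" "d \<noteq> 0"
  shows "edges_to_row d i j = edge (i, j) (i, j + d)"
proof -
  have "\<not> kadj (i, j) (i - 1, j + d)" "\<not> kadj (i, j) (i + 1, j + d)"
    using assms by (simp_all add: kadj_def)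
  then show ?thesis by (simp add: edges_to_row_def edge_def)
qed

text \<open>
  Every triangle has exactly one horizontal side, say from (i, j') to (i + 1, j'); the rays leave
  the triangle at half height.  The test decides whether the third vertex lies above that side.
\<close>
definition tri_parity :: "int \<times> int \<Rightarrow> int \<times> int \<Rightarrow> int \<times> int \<Rightarrow> bool" where
  "tri_parity p q r =
     (let i = min (fst p) (min (fst q) (fst r)); j = min (snd p) (min (snd q) (snd r))
      in odd (if snd p + snd q + snd r = 3 * j + 1 then crossings 1 i j else crossings (- 1) i (j + 1)))"

lemma tri_parity_rotate: "tri_parity p q r = tri_parity q r p"
  by (simp only: tri_parity_def ac_simps)

lemma tri_parity_swap: "tri_parity p q r = tri_parity p r q"
  by (simp only: tri_parity_def ac_simps)

text \<open>This and the next two lemmas compare the colours of two triangles across a horizontal, a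
  diagonal and a vertical edge.\<close>

lemma flip_horizontal:
  "odd (crossings 1 i j) \<noteq> odd (crossings (- 1) i j) \<longleftrightarrow> odd (edge (i, j) (i + 1, j))"
  using crossings_horizontal[of i j] unfolding even_add by blast

text \<open>The parity of \<open>i + j\<close> decides which diagonal of the unit square is an
  adjacency.\<close>

lemma flip_diagonal:
  "even (i + j) \<Longrightarrow>
     odd (crossings 1 i j) \<noteq> odd (crossings (- 1) i (j + 1)) \<longleftrightarrow> odd (edge (i, j) (i + 1, j + 1))"
  "odd (i + j) \<Longrightarrow>
     odd (crossings 1 i j) \<noteq> odd (crossings (- 1) i (j + 1)) \<longleftrightarrow> odd (edge (i + 1, j) (i, j + 1))"
proof -
  have "even (i + j) \<Longrightarrow> edge (i + 1, j) (i, j + 1) = 0"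
    "odd (i + j) \<Longrightarrow> edge (i, j) (i + 1, j + 1) = 0"
    by (simp_all add: edge_def kadj_def)
  then show
    "even (i + j) \<Longrightarrow>
     odd (crossings 1 i j) \<noteq> odd (crossings (- 1) i (j + 1)) \<longleftrightarrow> odd (edge (i, j) (i + 1, j + 1))"
    "odd (i + j) \<Longrightarrow>
     odd (crossings 1 i j) \<noteq> odd (crossings (- 1) i (j + 1)) \<longleftrightarrow> odd (edge (i + 1, j) (i, j + 1))"
    using crossings_diagonal[of i j] by auto
qed

text \<open>Every vertical edge has exactly one mixed end, here \<open>(i, j)\<close>. The
  horizontal sides of both triangles lie in its row, and its only edge into row \<open>j + d\<close>
  is the vertical one.\<close>

lemma flip_vertical:
  "odd (i + j) \<Longrightarrow> d \<noteq> 0 \<Longrightarrow>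
     odd (crossings d (i - 1) j) \<noteq> odd (crossings d i j) \<longleftrightarrow> odd (edge (i, j) (i, j + d))"
  using crossings_step[of d i j] edges_to_row_mixed[of i j d] by auto

text \<open>The two triangles share the edge from \<open>v\<close> to \<open>link v k\<close>, so
  their colours differ exactly when \<open>J\<close> contains that edge. The proof checks each
  direction of the link.\<close>

lemma tri_parity_link:
  "tri_parity v (link v (k - 1)) (link v k) \<noteq> tri_parity v (link v k) (link v (k + 1))
     \<longleftrightarrow> v \<in> J \<and> link v k \<in> J"
proof -
  obtain r where r: "r \<in> {0..<link_length v}" "\<And>d. link v (k + d) = link v (r + d)"
    using link_cases by blast
  obtain x y where v: "v = (x, y)" by (cases v)
  have "tri_parity v (link v (r - 1)) (link v r) \<noteq> tri_parity v (link v r) (link v (r + 1))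
     \<longleftrightarrow> odd (edge (link v r) v)"
  proof (cases "even (x + y)")
    case True
    have r_cases: "r \<in> {0, 1, 2, 3, 4, 5, 6, 7}" using r(1) True by (simp add: v link_indices)
    have tri:
      "tri_parity (x, y) (x + 1, y) (x + 1, y + 1) = odd (crossings 1 x y)"
      "tri_parity (x, y) (x + 1, y + 1) (x, y + 1) = odd (crossings (- 1) x (y + 1))"
      "tri_parity (x, y) (x, y + 1) (x - 1, y + 1) = odd (crossings (- 1) (x - 1) (y + 1))"
      "tri_parity (x, y) (x - 1, y + 1) (x - 1, y) = odd (crossings 1 (x - 1) y)"
      "tri_parity (x, y) (x - 1, y) (x - 1, y - 1) = odd (crossings (- 1) (x - 1) y)"
      "tri_parity (x, y) (x - 1, y - 1) (x, y - 1) = odd (crossings 1 (x - 1) (y - 1))"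
      "tri_parity (x, y) (x, y - 1) (x + 1, y - 1) = odd (crossings 1 x (y - 1))"
      "tri_parity (x, y) (x + 1, y - 1) (x + 1, y) = odd (crossings (- 1) x y)"
      by (simp_all add: tri_parity_def)
    \<comment> \<open>The vertical edges at a pure point have their mixed ends at
      \<open>(x, y + 1)\<close> and \<open>(x, y - 1)\<close>, hence the shifted instances of
      \<open>flip_vertical\<close> below.\<close>
    have flip:
      "odd (crossings (- 1) x y) \<noteq> odd (crossings 1 x y) \<longleftrightarrow> odd (edge (x + 1, y) (x, y))"
      "odd (crossings 1 x y) \<noteq> odd (crossings (- 1) x (y + 1)) \<longleftrightarrow> odd (edge (x + 1, y + 1) (x, y))"
      "odd (crossings (- 1) x (y + 1)) \<noteq> odd (crossings (- 1) (x - 1) (y + 1)) \<longleftrightarrow> odd (edge (x, y + 1) (x, y))"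
      "odd (crossings (- 1) (x - 1) (y + 1)) \<noteq> odd (crossings 1 (x - 1) y) \<longleftrightarrow> odd (edge (x - 1, y + 1) (x, y))"
      "odd (crossings 1 (x - 1) y) \<noteq> odd (crossings (- 1) (x - 1) y) \<longleftrightarrow> odd (edge (x - 1, y) (x, y))"
      "odd (crossings (- 1) (x - 1) y) \<noteq> odd (crossings 1 (x - 1) (y - 1)) \<longleftrightarrow> odd (edge (x - 1, y - 1) (x, y))"
      "odd (crossings 1 (x - 1) (y - 1)) \<noteq> odd (crossings 1 x (y - 1)) \<longleftrightarrow> odd (edge (x, y - 1) (x, y))"
      "odd (crossings 1 x (y - 1)) \<noteq> odd (crossings (- 1) x y) \<longleftrightarrow> odd (edge (x + 1, y - 1) (x, y))"
      using flip_horizontal[of x y] flip_horizontal[of "x - 1" y]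
        flip_diagonal(1)[of x y] flip_diagonal(2)[of "x - 1" y]
        flip_diagonal(1)[of "x - 1" "y - 1"] flip_diagonal(2)[of x "y - 1"]
        flip_vertical[of x "y + 1" "- 1"] flip_vertical[of x "y - 1" 1]
        True
      by (auto simp: edge_sym)
    from r_cases show ?thesis
      by (elim insertE emptyE; hypsubst) (use True in \<open>simp_all add: v link_def ring_simps tri flip[symmetric]\<close>)
  next
    case False
    have r_cases: "r \<in> {0, 1, 2, 3}" using r(1) False by (simp add: v link_indices)
    have tri:
      "tri_parity (x, y) (x + 1, y) (x, y + 1) = odd (crossings 1 x y)"
      "tri_parity (x, y) (x, y + 1) (x - 1, y) = odd (crossings 1 (x - 1) y)"
      "tri_parity (x, y) (x - 1, y) (x, y - 1) = odd (crossings (- 1) (x - 1) y)"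
      "tri_parity (x, y) (x, y - 1) (x + 1, y) = odd (crossings (- 1) x y)"
      by (simp_all add: tri_parity_def)
    have flip:
      "odd (crossings (- 1) x y) \<noteq> odd (crossings 1 x y) \<longleftrightarrow> odd (edge (x + 1, y) (x, y))"
      "odd (crossings 1 x y) \<noteq> odd (crossings 1 (x - 1) y) \<longleftrightarrow> odd (edge (x, y + 1) (x, y))"
      "odd (crossings 1 (x - 1) y) \<noteq> odd (crossings (- 1) (x - 1) y) \<longleftrightarrow> odd (edge (x - 1, y) (x, y))"
      "odd (crossings (- 1) (x - 1) y) \<noteq> odd (crossings (- 1) x y) \<longleftrightarrow> odd (edge (x, y - 1) (x, y))"
      using flip_horizontal[of x y] flip_horizontal[of "x - 1" y]
        flip_vertical[of x y "- 1"] flip_vertical[of x y 1]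
        False
      by (auto simp: edge_sym)
    from r_cases show ?thesis
      by (elim insertE emptyE; hypsubst) (use False in \<open>simp_all add: v link_def ring_simps tri flip[symmetric]\<close>)
  qed
  moreover have "odd (edge (link v r) v) \<longleftrightarrow> v \<in> J \<and> link v r \<in> J"
    using kadj_link kadj_sym by (auto simp: edge_def)
  ultimately show ?thesis using r(2)[of 0] r(2)[of 1] r(2)[of "-1"] by simp
qed

subsection \<open>The two sides of the curve\<close>

text \<open>The triangle at index 0 is an arbitrary choice: for \<open>n\<close> outside
  \<open>J\<close> all triangles at \<open>n\<close> have the same colour.\<close>

definition side :: "int \<times> int \<Rightarrow> bool" where
  "side n = tri_parity n (link n 0) (link n 1)"

text \<open>No edge of \<open>J\<close> ends at \<open>n\<close>, so the colour never changes on the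
  way around its link.\<close>

lemma tri_parity_side:
  assumes "n \<notin> J" "kadj n p" "kadj n q" "kadj p q"
  shows "tri_parity n p q = side n"
proof -
  let ?T = "\<lambda>k. tri_parity n (link n k) (link n (k + 1))"
  have step: "?T (k - 1) = ?T k" for k
    using tri_parity_link[of n k] assms(1) by simp
  have T: "?T k = side n" for k
  proof (induction k rule: int_induct[of _ 0])
    case base
    show ?case by (simp add: side_def)
  next
    case (step1 i)
    then show ?case using step[of "i + 1"] by simp
  next
    case (step2 i)
    then show ?case using step[of i] by simp
  qed
  obtain k where "{p, q} = {link n k, link n (k + 1)}"
    using link_triangle[OF assms(2-4)] by blast
  then show ?thesis
    using T[of k] tri_parity_swap[of n p q] by (auto simp: doubleton_eq_iff)
qed

text \<open>The same triangle is viewed from its vertex \<open>link v k\<close>, which is outside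
  \<open>J\<close>, instead of from \<open>v\<close>.\<close>

lemma side_link:
  assumes "link v k \<notin> J"
  shows "side (link v k) = tri_parity v (link v k) (link v (k + 1))"
    and "side (link v k) = tri_parity v (link v (k - 1)) (link v k)"
proof -
  have adj: "kadj (link v k) (link v (k + 1))" "kadj (link v k) (link v (k - 1))" "kadj (link v k) v"
    "kadj (link v (k + 1)) v" "kadj v (link v (k - 1))"
    using kadj_link_link[of v k] kadj_link_link[of v "k - 1"] kadj_link kadj_sym by auto
  show "side (link v k) = tri_parity v (link v k) (link v (k + 1))"
    using tri_parity_side[OF assms adj(1,3,4)] tri_parity_rotate[of v "link v k"] by simp
  show "side (link v k) = tri_parity v (link v (k - 1)) (link v k)"
    using tri_parity_side[OF assms adj(3,2,5)] tri_parity_rotate[of "link v k" v] by simp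
qed

text \<open>Adjacent points lie in a common triangle, whose colour is the side of both.\<close>

lemma side_kadj:
  assumes "p \<notin> J" "q \<notin> J" "kadj p q"
  shows "side p = side q"
proof -
  obtain k where q: "q = link p k" using link_range assms(3) by blast
  have "side p = tri_parity p q (link p (k + 1))"
    using assms(1) kadj_link kadj_link_link by (simp add: tri_parity_side q)
  then show ?thesis using side_link(1)[of p k] assms(2) q by simp
qed

section \<open>Joining points in the complement of the curve\<close>

abbreviation joined :: "int \<times> int \<Rightarrow> int \<times> int \<Rightarrow> bool" where
  "joined \<equiv> connected_component_of (subtopology khal2 (- J))"

lemma joined_refl: "p \<notin> J \<Longrightarrow> joined p p"
  by (simp add: connected_component_of_refl topspace_khal2)

lemma joined_notin: "joined p q \<Longrightarrow> q \<notin> J"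
  by (auto simp: connected_component_of_def connectedin_subtopology)

lemma joined_sym: "joined p q \<Longrightarrow> joined q p"
  by (simp add: connected_component_of_sym)

lemma joined_trans: "joined p q \<Longrightarrow> joined q r \<Longrightarrow> joined p r"
  by (rule connected_component_of_trans)

lemma joined_kadj: "p \<notin> J \<Longrightarrow> q \<notin> J \<Longrightarrow> kadj p q \<Longrightarrow> joined p q"
  unfolding connected_component_of_def
  by (intro exI[of _ "{p, q}"]) (simp add: connectedin_subtopology connectedin_pair_iff)

lemma joined_side:
  assumes "joined p q"
  shows "side p = side q"
proof -
  obtain T where T: "connectedin khal2 T" "T \<inter> J = {}" "p \<in> T" "q \<in> T"
    using assms by (auto simp: connected_component_of_def connectedin_subtopology)
  have "{r \<in> T. side r = side p} = T"
    using T by (intro kadj_closed_subset_connectedin) (use side_kadj in blast)+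
  then show ?thesis using T(4) by auto
qed

text \<open>Consecutive link points are adjacent, so a stretch of the link that avoids
  \<open>J\<close> is connected and has the colour of its first triangle.\<close>

lemma link_arc:
  assumes "i < k" "k < j" and free: "\<And>l. i < l \<Longrightarrow> l < j \<Longrightarrow> link v l \<notin> J"
  shows "joined (link v (i + 1)) (link v k)"
    and "side (link v k) = tri_parity v (link v i) (link v (i + 1))"
proof -
  have "i + 1 \<le> k" using assms(1) by simp
  then show "joined (link v (i + 1)) (link v k)"
    using assms(2)
  proof (induction rule: int_ge_induct)
    case base
    then show ?case using free by (simp add: joined_refl)
  next
    case (step l)
    then have "joined (link v l) (link v (l + 1))"
      using free kadj_link_link by (intro joined_kadj) auto
    with step show ?case by (auto intro: joined_trans)
  qed
  then have "side (link v k) = side (link v (i + 1))"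
    using joined_side by blast
  also have "\<dots> = tri_parity v (link v i) (link v (i + 1))"
    using side_link(2)[of v "i + 1"] free[of "i + 1"] assms by simp
  finally show "side (link v k) = tri_parity v (link v i) (link v (i + 1))" .
qed

text \<open>The two neighbours of \<open>v\<close> in \<open>J\<close> cut the periodic link into
  the arcs from \<open>a\<close> to \<open>b\<close> and from \<open>b\<close> to
  \<open>a + link_length v\<close>.\<close>

lemma link_two:
  assumes "v \<in> J"
  obtains a b where "a < b" "b < a + link_length v" "link v a \<in> J" "link v b \<in> J"
    and "\<And>k. a < k \<Longrightarrow> k < b \<Longrightarrow> link v k \<notin> J"
    and "\<And>k. b < k \<Longrightarrow> k < a + link_length v \<Longrightarrow> link v k \<notin> J"
proof -
  let ?s = "link_length v"
  obtain p q where pq: "p \<noteq> q" "{w \<in> J. kadj v w} = {p, q}"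
    using neighbours[OF assms] by blast
  then have "kadj v p" "kadj v q" by auto
  then obtain a' b' where ab': "a' \<in> {0..<?s}" "b' \<in> {0..<?s}" "p = link v a'" "q = link v b'"
    unfolding link_range by blast
  define a b where "a = min a' b'" and "b = max a' b'"
  have "a' \<noteq> b'" using pq ab' by auto
  then have ab: "0 \<le> a" "a < b" "b < ?s" "{p, q} = {link v a, link v b}"
    using ab' by (auto simp: a_def b_def min_def max_def)
  have free: "l \<in> {a, b}" if l: "0 \<le> l" "l < ?s" "link v l \<in> J" for l
  proof -
    have "link v l \<in> {link v a, link v b}" using l(3) kadj_link pq(2) ab(4) by blast
    then show ?thesis using inj_onD[OF link_inj, of v l] l ab by auto
  qed
  \<comment> \<open>The second arc runs past the end of the period; its later indices are shifted
    back by one period.\<close>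
  have wrap: "link v k = link v (k - ?s)" for k
    by (rule link_periodic) (simp add: mod_diff_right_eq)
  show thesis
  proof
    show "a < b" "b < a + ?s" using ab by auto
    show "link v a \<in> J" "link v b \<in> J" using pq ab(4) by blast+
    show "link v k \<notin> J" if "a < k" "k < b" for k
      using free[of k] that ab by auto
    show "link v k \<notin> J" if "b < k" "k < a + ?s" for k
      using free[of k] free[of "k - ?s"] that ab wrap[of k] by (cases "k < ?s") auto
  qed
qed

text \<open>The two arcs of the link have opposite colours, so points on the same side lie on the
  same arc, which is connected.\<close>

lemma link_same_side:
  assumes v: "v \<in> J" and "n \<notin> J" "m \<notin> J" "kadj v n" "kadj v m" "side n = side m"
  shows "joined n m"
proof -
  let ?s = "link_length v" and ?T = "\<lambda>k. tri_parity v (link v k) (link v (k + 1))"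
  obtain a b where ab: "a < b" "b < a + ?s" "link v a \<in> J" "link v b \<in> J"
    and free: "\<And>k. a < k \<Longrightarrow> k < b \<Longrightarrow> link v k \<notin> J"
      "\<And>k. b < k \<Longrightarrow> k < a + ?s \<Longrightarrow> link v k \<notin> J"
    using link_two[OF v] by blast
  \<comment> \<open>The first and the last triangle over the first arc agree in colour; for
    \<open>b = a + 1\<close> they are the same triangle.\<close>
  have "?T (b - 1) = ?T a"
  proof (cases "b = a + 1")
    case False
    then show ?thesis
      using side_link(1)[of v "b - 1"] link_arc(2)[of a "b - 1" b v] free(1) ab(1) by simp
  qed simp
  then have flip: "?T a \<noteq> ?T b"
    using tri_parity_link[of v b] v ab(4) by simp
  have pos: "\<exists>k. w = link v k \<and> (a < k \<and> k < b \<or> b < k \<and> k < a + ?s)" if w: "w \<notin> J" "kadj v w" for w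
  proof -
    obtain k where k: "w = link v k" using w(2) link_range by blast
    \<comment> \<open>The representative of \<open>k\<close> in the period that starts at
      \<open>a\<close>.\<close>
    define l where "l = a + (k - a) mod ?s"
    have "?s > 0" by (simp add: link_length_def)
    then have "a \<le> l" "l < a + ?s" by (simp_all add: l_def)
    moreover have "w = link v l"
      unfolding k by (rule link_periodic) (simp add: l_def mod_add_right_eq)
    moreover have "l \<noteq> a" "l \<noteq> b" using calculation(3) w(1) ab by auto
    ultimately show ?thesis by (intro exI[of _ l]) auto
  qed
  obtain k l where kl: "n = link v k" "a < k \<and> k < b \<or> b < k \<and> k < a + ?s"
    "m = link v l" "a < l \<and> l < b \<or> b < l \<and> l < a + ?s"
    using pos assms by metis
  have A: "joined (link v (a + 1)) (link v i) \<and> side (link v i) = ?T a" if "a < i \<and> i < b" for i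
    using link_arc[of a i b v] free(1) that by blast
  have B: "joined (link v (b + 1)) (link v i) \<and> side (link v i) = ?T b" if "b < i \<and> i < a + ?s" for i
    using link_arc[of b i "a + ?s" v] free(2) that by blast
  show ?thesis
    using kl A[of k] A[of l] B[of k] B[of l] flip assms(6) joined_sym joined_trans by metis
qed

text \<open>The edge lies in two triangles. Their third vertices are outside \<open>J\<close>
  because \<open>J\<close> has no triangle, and they are on opposite sides because the edge belongs
  to \<open>J\<close>, so each value \<open>c\<close> occurs.\<close>

lemma edge_apex:
  assumes "v \<in> J" "u \<in> J" "kadj v u"
  shows "\<exists>w. w \<notin> J \<and> kadj v w \<and> kadj u w \<and> side w = c"
proof -
  obtain k where u: "u = link v k" using assms(3) link_range by blast
  have adj: "kadj u (link v (k + 1))" "kadj u (link v (k - 1))"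
    using kadj_link_link[of v k] kadj_link_link[of v "k - 1"] kadj_sym by (auto simp: u)
  have notin: "link v (k + 1) \<notin> J" "link v (k - 1) \<notin> J"
    using no_triangle[OF assms(1,2) _ assms(3)] adj kadj_link by blast+
  have "side (link v (k - 1)) \<noteq> side (link v (k + 1))"
    using tri_parity_link[of v k] side_link(1)[OF notin(2)] side_link(2)[OF notin(1)] assms u by simp
  then show ?thesis
    using adj notin kadj_link by (metis (full_types))
qed

lemma neighbour_on_side:
  assumes "v \<in> J"
  shows "\<exists>w. w \<notin> J \<and> kadj v w \<and> side w = c"
  using neighbours[OF assms] edge_apex[OF assms] by blast

text \<open>Propagation along \<open>J\<close>: adjacent points \<open>x\<close> and
  \<open>y\<close> of \<open>J\<close> have a common neighbour \<open>w\<close> on the side of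
  \<open>n\<close>, and \<open>link_same_side\<close> applies at \<open>x\<close> and then at
  \<open>y\<close>.\<close>

lemma same_side_near:
  assumes "v \<in> J" "u \<in> J" "n \<notin> J" "m \<notin> J" "kadj v n" "kadj u m" "side n = side m"
  shows "joined n m"
proof -
  let ?S = "{v \<in> J. \<forall>m. m \<notin> J \<longrightarrow> kadj v m \<longrightarrow> side n = side m \<longrightarrow> joined n m}"
  have "?S = J"
  proof (rule kadj_closed_subset_connectedin[OF connected])
    show "?S \<noteq> {}" using assms link_same_side by blast
    fix x y assume x: "x \<in> ?S" and y: "y \<in> J" "kadj x y"
    obtain w where w: "w \<notin> J" "kadj x w" "kadj y w" "side w = side n"
      using edge_apex[of x y] x y by blast
    then have "joined n w" using x w(4)[symmetric] by blast
    then have "joined n m" if "m \<notin> J" "kadj y m" "side n = side m" for m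
      using link_same_side[OF y(1) w(1) that(1) w(3) that(2)] w(4) that(3) joined_trans by auto
    with y show "y \<in> ?S" by auto
  qed auto
  then show ?thesis using assms by blast
qed

section \<open>The components of the complement\<close>

text \<open>A component that never comes next to \<open>J\<close> is closed under adjacency, hence
  the whole plane, which leaves no room for \<open>J\<close>.\<close>

lemma joined_near:
  assumes "p \<notin> J"
  shows "\<exists>n v. joined p n \<and> v \<in> J \<and> kadj v n"
proof (rule ccontr)
  assume no: "\<nexists>n v. joined p n \<and> v \<in> J \<and> kadj v n"
  have "{q. joined p q} = UNIV"
  proof (rule kadj_closed_subset_connectedin)
    show "connectedin khal2 UNIV"
      using connected_space_khal2 by (metis connectedin_topspace topspace_khal2)
    show "{q. joined p q} \<noteq> {}" using joined_refl[OF assms] by blast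
    fix x y assume "x \<in> {q. joined p q}" "kadj x y"
    then show "y \<in> {q. joined p q}"
      using no joined_kadj[of x y] joined_notin joined_trans kadj_sym by blast
  qed auto
  then have "J = {}" using joined_notin by blast
  with nonempty show False by simp
qed

lemma joined_iff: "joined p q \<longleftrightarrow> p \<notin> J \<and> q \<notin> J \<and> side p = side q"
proof
  assume "joined p q"
  then show "p \<notin> J \<and> q \<notin> J \<and> side p = side q"
    using joined_notin joined_sym joined_side by blast
next
  assume pq: "p \<notin> J \<and> q \<notin> J \<and> side p = side q"
  then obtain n v m u where *: "joined p n" "v \<in> J" "kadj v n" "joined q m" "u \<in> J" "kadj u m"
    using joined_near by metis
  then have "joined n m"
    using pq joined_side joined_notin by (intro same_side_near[of v u]) auto
  with * show "joined p q" using joined_sym joined_trans by blast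
qed

text \<open>By \<open>joined_iff\<close> the components are the nonempty fibres of
  \<open>side\<close>; both values occur next to any point of \<open>J\<close>.\<close>

lemma components_of_complement:
  "connected_components_of (subtopology khal2 (- J)) = (\<lambda>c. {p. p \<notin> J \<and> side p = c}) ` UNIV"
proof -
  have "connected_component_of_set (subtopology khal2 (- J)) p = {q. q \<notin> J \<and> side q = side p}"
    if "p \<notin> J" for p
    using that by (auto simp: joined_iff)
  then have "connected_components_of (subtopology khal2 (- J)) = (\<lambda>c. {p. p \<notin> J \<and> side p = c}) ` side ` (- J)"
    unfolding connected_components_of_def image_image
    by (intro image_cong) (simp_all add: topspace_khal2)
  moreover have "side ` (- J) = UNIV"
    using nonempty neighbour_on_side by blast
  ultimately show ?thesis by simp
qed

lemma card_components_of_complement: "card (connected_components_of (subtopology khal2 (- J))) = 2"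
proof -
  have "inj (\<lambda>c. {p. p \<notin> J \<and> side p = c})"
    using nonempty neighbour_on_side by (intro injI) blast
  then show ?thesis
    unfolding components_of_complement by (simp add: card_image)
qed

lemma adjacent_to_components:
  assumes "v \<in> J" "C \<in> connected_components_of (subtopology khal2 (- J))"
  shows "adjacent_to v C"
  using assms neighbour_on_side
  unfolding components_of_complement adjacent_to_def adjacency_set_eq by blast

end

theorem theorem7p2:
  fixes J :: "(int \<times> int) set"
  assumes "jordan_curve J"
    and "card J > 4"
    and "Gamma_star (Gamma_map -` J) = J"
  shows "card (connected_components_of (subtopology khal2 (- J))) = 2
    \<and> (\<forall>x\<in>J. \<forall>C\<in>connected_components_of (subtopology khal2 (- J)). adjacent_to x C)"
proof -
  interpret khal_cycle J
  proof
    show "connectedin khal2 J" using assms(1) by (simp add: jordan_curve_def)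
    \<comment> \<open>An infinite set or the empty set would have cardinality 0.\<close>
    show "finite J" "J \<noteq> {}" using assms(2) card.infinite by fastforce+
    show "\<exists>p q. p \<noteq> q \<and> {w \<in> J. kadj v w} = {p, q}" if "v \<in> J" for v
      using jordan_curve_neighbours[OF assms(1,2) that] by metis
  qed (rule jordan_curve_no_triangle[OF assms(1)])
  show ?thesis
    using card_components_of_complement adjacent_to_components by blast
qed

end
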